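(* For $x\in 2^{\mathbb N}$ let $\approx_T^x$ be the equivalence relation on $\mathbb N$ given by $i\approx_T^x j\iff \varphi_i^x=\varphi_j^x$. The map $x\mapsto{\approx_T^x}$ from $2^{\mathbb N}$ to the space $\mathrm{ER}$ of equivalence relations on $\mathbb N$ is a Borel reduction from $\le_T$ to $\le_c$ (and hence from $\equiv_T$ to $\sim_c$).
   Context: $\le_T$ and $\equiv_T$ are Turing reducibility and Turing equivalence on $2^{\mathbb N}$. $(\varphi_i^x)_{i\in\mathbb N}$ is the standard numbering of the partial unary computable-in-$x$ functions; $\varphi_i^x=\varphi_j^x$ means equality as partial functions. Given binary relations $R$ on $X$ and $S$ on $Y$, a reduction from $R$ to $S$ is a function $f:X\to Y$ such that $x\mathrel R y\iff f(x)\mathrel S f(y)$ for all $x,y\in X$. If $X,Y$ are standard Borel spaces, a Borel reduction is a reduction that is a Borel function. For binary relations $R,S$ on $\mathbb N$, $R\le_c S$ ($R$ is computably reducible to $S$) means there is a computable function $\mathbb N\to\mathbb N$ that is a reduction from $R$ to $S$; $R\sim_c S$ means $R\le_c S$ and $S\le_c R$. $\mathrm{ER}\subseteq 2^{\mathbb N\times\mathbb N}$ is the closed subset (hence Polish space) of all equivalence relations on $\mathbb N$, and $\le_c$, $\sim_c$ are regarded as relations on $\mathrm{ER}$. *)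

theory Defs
  imports "HOL-Analysis.Analysis" "HOL-Library.Nat_Bijection"
begin

section \<open>Partial computable functions relative to an oracle\<close>

text \<open>
  Unary partial recursive functions with an oracle.  Tuples are passed through the Cantor
  pairing function \<^const>\<open>prod_encode\<close>, so that all programs compute unary partial functions;
  for instance, \<open>Pair First Second\<close> is the identity.  In \<open>Prec\<close> and \<open>Mu\<close> the input is a pair whose
  first component is the parameter: \<open>Prec p q\<close> maps \<open>(a, 0)\<close> to \<open>p a\<close> and \<open>(a, k + 1)\<close> to
  \<open>q (a, (k, v))\<close>, where \<open>v\<close> is its value at \<open>(a, k)\<close>, and \<open>Mu p\<close> maps \<open>n\<close> to the least \<open>m\<close>
  with \<open>p (n, m) = 0\<close>, all earlier values being defined.  Divergence is \<^const>\<open>None\<close>.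
\<close>

datatype prog =
    Zero | Succ | First | Second | Oracle
  | Pair prog prog
  | Comp prog prog
  | Prec prog prog
  | Mu prog

primrec eval :: "(nat \<Rightarrow> bool) \<Rightarrow> prog \<Rightarrow> nat \<Rightarrow> nat option" where
  "eval x Zero = (\<lambda>n. Some 0)"
| "eval x Succ = (\<lambda>n. Some (Suc n))"
| "eval x First = (\<lambda>n. Some (fst (prod_decode n)))"
| "eval x Second = (\<lambda>n. Some (snd (prod_decode n)))"
| "eval x Oracle = (\<lambda>n. Some (of_bool (x n)))"
| "eval x (Pair p q) = (\<lambda>n. Option.bind (eval x p n) (\<lambda>a.
     Option.bind (eval x q n) (\<lambda>b. Some (prod_encode (a, b)))))"
| "eval x (Comp p q) = (\<lambda>n. Option.bind (eval x q n) (eval x p))"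
| "eval x (Prec p q) = (\<lambda>n. case prod_decode n of (a, m) \<Rightarrow>
     rec_nat (eval x p a)
       (\<lambda>k r. Option.bind r (\<lambda>v. eval x q (prod_encode (a, prod_encode (k, v))))) m)"
| "eval x (Mu p) = (\<lambda>n.
     let P = (\<lambda>m. eval x p (prod_encode (n, m)) = Some 0 \<and>
                  (\<forall>k<m. eval x p (prod_encode (n, k)) \<noteq> None))
     in if \<exists>m. P m then Some (LEAST m. P m) else None)"

text \<open>Oracle-free programs compute the (plain) partial computable functions.\<close>

primrec oracle_free :: "prog \<Rightarrow> bool" where
  "oracle_free Zero = True"
| "oracle_free Succ = True"
| "oracle_free First = True"
| "oracle_free Second = True"
| "oracle_free Oracle = False"
| "oracle_free (Pair p q) = (oracle_free p \<and> oracle_free q)"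
| "oracle_free (Comp p q) = (oracle_free p \<and> oracle_free q)"
| "oracle_free (Prec p q) = (oracle_free p \<and> oracle_free q)"
| "oracle_free (Mu p) = oracle_free p"

text \<open>The numbering of the programs is an effective bijection onto the natural numbers.\<close>

primrec prog_encode :: "prog \<Rightarrow> nat" where
  "prog_encode Zero = 0"
| "prog_encode Succ = 1"
| "prog_encode First = 2"
| "prog_encode Second = 3"
| "prog_encode Oracle = 4"
| "prog_encode (Pair p q) = 5 + 4 * prod_encode (prog_encode p, prog_encode q)"
| "prog_encode (Comp p q) = 6 + 4 * prod_encode (prog_encode p, prog_encode q)"
| "prog_encode (Prec p q) = 7 + 4 * prod_encode (prog_encode p, prog_encode q)"
| "prog_encode (Mu p) = 8 + 4 * prog_encode p"

lemma inj_prog_encode: "inj prog_encode"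
proof (rule injI)
  fix p q
  show "prog_encode p = prog_encode q \<Longrightarrow> p = q"
  proof (induction p arbitrary: q)
    case (Pair p1 p2) then show ?case by (cases q) (auto, presburger+)
  next
    case (Comp p1 p2) then show ?case by (cases q) (auto, presburger+)
  next
    case (Prec p1 p2) then show ?case by (cases q) (auto, presburger+)
  next
    case (Mu p) then show ?case by (cases q) (auto, presburger+)
  qed (case_tac q; simp)+
qed

lemma surj_prog_encode: "surj prog_encode"
proof -
  have "\<exists>p. prog_encode p = n" for n
  proof (induction n rule: less_induct)
    case (less n)
    show ?case
    proof (cases "n < 5")
      case True
      then have "n \<in> {0, 1, 2, 3, 4}" by auto
      then show ?thesis
        by (metis insertE empty_iff prog_encode.simps(1-5))
    next
      case False
      define k where "k = (n - 5) div 4"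
      obtain a b where ab: "k = prod_encode (a, b)"
        by (metis prod_decode_inverse surj_pair)
      have "k < n" using False by (simp add: k_def)
      moreover have "a \<le> k" "b \<le> k"
        by (auto simp: ab le_prod_encode_1 le_prod_encode_2)
      ultimately obtain p q r
        where "prog_encode p = a" "prog_encode q = b" "prog_encode r = k"
        using less.IH by (meson le_less_trans)
      then have "prog_encode (Pair p q) = 5 + 4 * k" "prog_encode (Comp p q) = 6 + 4 * k"
        "prog_encode (Prec p q) = 7 + 4 * k" "prog_encode (Mu r) = 8 + 4 * k"
        by (simp_all add: ab)
      moreover have "n = 5 + 4 * k \<or> n = 6 + 4 * k \<or> n = 7 + 4 * k \<or> n = 8 + 4 * k"
        using False unfolding k_def by presburger
      ultimately show ?thesis by metis
    qed
  qed
  then show ?thesis by (metis surjI)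
qed

lemma bij_prog_encode: "bij prog_encode"
  by (simp add: bij_def inj_prog_encode surj_prog_encode)

definition phi :: "(nat \<Rightarrow> bool) \<Rightarrow> nat \<Rightarrow> nat \<Rightarrow> nat option" where
  "phi x i = eval x (inv prog_encode i)"

lemma phi_prog_encode: "phi x (prog_encode p) = eval x p"
  by (simp add: phi_def inj_prog_encode)

definition computable :: "(nat \<Rightarrow> nat) \<Rightarrow> bool" where
  "computable f \<longleftrightarrow> (\<exists>p. oracle_free p \<and> (\<forall>x n. eval x p n = Some (f n)))"

definition turing_le :: "(nat \<Rightarrow> bool) \<Rightarrow> (nat \<Rightarrow> bool) \<Rightarrow> bool" (infix "\<le>\<^sub>T" 50) where
  "x \<le>\<^sub>T y \<longleftrightarrow> (\<exists>i. \<forall>n. phi y i n = Some (of_bool (x n)))"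

definition turing_equiv :: "(nat \<Rightarrow> bool) \<Rightarrow> (nat \<Rightarrow> bool) \<Rightarrow> bool" (infix "\<equiv>\<^sub>T" 50) where
  "x \<equiv>\<^sub>T y \<longleftrightarrow> x \<le>\<^sub>T y \<and> y \<le>\<^sub>T x"

section \<open>Reductions between binary relations\<close>

definition reduction_on ::
  "'a set \<Rightarrow> ('a \<Rightarrow> 'a \<Rightarrow> bool) \<Rightarrow> 'b set \<Rightarrow> ('b \<Rightarrow> 'b \<Rightarrow> bool) \<Rightarrow> ('a \<Rightarrow> 'b) \<Rightarrow> bool" where
  "reduction_on X R Y S f \<longleftrightarrow>
     f \<in> X \<rightarrow> Y \<and> (\<forall>x\<in>X. \<forall>y\<in>X. R x y \<longleftrightarrow> S (f x) (f y))"

definition borel_reduction_on ::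
  "'a::topological_space set \<Rightarrow> ('a \<Rightarrow> 'a \<Rightarrow> bool) \<Rightarrow>
   'b::topological_space set \<Rightarrow> ('b \<Rightarrow> 'b \<Rightarrow> bool) \<Rightarrow> ('a \<Rightarrow> 'b) \<Rightarrow> bool" where
  "borel_reduction_on X R Y S f \<longleftrightarrow>
     reduction_on X R Y S f \<and> f \<in> restrict_space borel X \<rightarrow>\<^sub>M restrict_space borel Y"

text \<open>
  A binary relation on \<^typ>\<open>nat\<close> is represented by its characteristic function, an element of
  the space \<^typ>\<open>nat \<times> nat \<Rightarrow> bool\<close> with the product topology (\<^typ>\<open>bool\<close> is discrete).
\<close>

instance bool :: second_countable_topology
proof
  have "open = generate_topology (UNIV :: bool set set)"
    by (auto simp: fun_eq_iff open_discrete intro: generate_topology.Basis)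
  then show "\<exists>B::bool set set. countable B \<and> open = generate_topology B"
    using countable_finite[OF finite] by blast
qed

definition ER :: "(nat \<times> nat \<Rightarrow> bool) set" where
  "ER = {E. equivp (curry E)}"

lemma closed_ER: "closed ER"
proof -
  have eq: "ER = (\<Inter>i j k. {E. E (i, i) \<and> (E (i, j) \<longrightarrow> E (j, i)) \<and>
                               (E (i, j) \<longrightarrow> E (j, k) \<longrightarrow> E (i, k))})"
    unfolding ER_def equivp_reflp_symp_transp reflp_def symp_def transp_def by (simp add: set_eq_iff) blast
  have op: "open {E :: nat \<times> nat \<Rightarrow> bool. E p = b}" for p b
  proof -
    have "open ((\<lambda>E :: nat \<times> nat \<Rightarrow> bool. E p) -` {b})"
      by (intro open_vimage open_discrete continuous_on_product_coordinates)
    then show ?thesis by (simp add: vimage_def)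
  qed
  have cl1: "closed {E :: nat \<times> nat \<Rightarrow> bool. E p}" for p
    using op[of p False] by (simp add: closed_def Collect_neg_eq)
  have cl2: "open {E :: nat \<times> nat \<Rightarrow> bool. E p}" for p
    using op[of p True] by simp
  show ?thesis unfolding eq
    by (intro closed_INT ballI closed_Collect_conj closed_Collect_imp cl1 cl2)
qed

definition comp_le :: "(nat \<times> nat \<Rightarrow> bool) \<Rightarrow> (nat \<times> nat \<Rightarrow> bool) \<Rightarrow> bool" (infix "\<le>\<^sub>c" 50) where
  "R \<le>\<^sub>c S \<longleftrightarrow> (\<exists>f. computable f \<and> reduction_on UNIV (curry R) UNIV (curry S) f)"

definition comp_equiv :: "(nat \<times> nat \<Rightarrow> bool) \<Rightarrow> (nat \<times> nat \<Rightarrow> bool) \<Rightarrow> bool" (infix "\<sim>\<^sub>c" 50) where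
  "R \<sim>\<^sub>c S \<longleftrightarrow> R \<le>\<^sub>c S \<and> S \<le>\<^sub>c R"

definition phi_eq :: "(nat \<Rightarrow> bool) \<Rightarrow> nat \<times> nat \<Rightarrow> bool" where
  "phi_eq x = (\<lambda>(i, j). phi x i = phi x j)"

lemma phi_eq_in_ER: "phi_eq x \<in> ER"
  by (simp add: phi_eq_def ER_def equivp_reflp_symp_transp reflp_def symp_def transp_def)

end

theory Submission
  imports Defs
begin

text \<open>
  A universal program carries both directions.  It exists because a stack machine, whose single
  step is computable from the oracle on codes of configurations, runs every program
  (\<open>eval_iff_machine\<close>, \<open>universal_program\<close>).

  If \<open>x\<close> is computed from \<open>y\<close> by a program \<open>p\<close>, then replacing every oracle call in the universal
  program by \<open>p\<close> gives a program that interprets, with oracle \<open>y\<close>, all programs with oracle \<open>x\<close>.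
  Hardwiring the first argument \<open>i\<close> of this interpreter is a computable operation on codes, and the
  resulting program with oracle \<open>y\<close> computes \<open>phi x i\<close> itself.  So this operation is a reduction.

  Conversely, let a computable \<open>f\<close> reduce \<open>phi_eq x\<close> to \<open>phi_eq y\<close>.  The constant functions 0 and 1
  are different, so \<open>f\<close> sends their codes to programs that, with oracle \<open>y\<close>, differ at some input
  \<open>m\<close>.  Hence for one of the two constants, \<open>a\<close>, the image halts at \<open>m\<close> with some value \<open>v\<close>, while for
  the other, \<open>b\<close>, the image does not return \<open>v\<close> at \<open>m\<close>; it may well diverge there.  Uniformly in
  \<open>n\<close> there is a code of a program that asks the oracle about \<open>n\<close> and then behaves like the
  constant \<open>a\<close> if \<open>x n\<close> holds and like the constant \<open>b\<close> otherwise.  Its image under \<open>f\<close> returns \<open>v\<close>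
  at \<open>m\<close> exactly if \<open>x n\<close> holds.  Exchanging \<open>a\<close> and \<open>b\<close> gives a program whose image returns \<open>v\<close> at
  \<open>m\<close> exactly if \<open>x n\<close> fails.  So \<open>x\<close> and its complement are both semidecidable with oracle \<open>y\<close>,
  and running the two searches in parallel decides \<open>x\<close> (\<open>turing_leI_semidecidable\<close>).

  The map is Borel because each value \<open>eval x p n\<close> arises from single bits of \<open>x\<close> by composition and
  countable quantification, as an induction on \<open>p\<close> shows.
\<close>

section \<open>Total functionals computed uniformly in the oracle\<close>

text \<open>
  One program has to work for all oracles.  The flag says whether it may query the oracle, so
  that one set of closure rules serves both for the step function of the machine, which does,
  and for the reductions, which must not.
\<close>

definition computable_op :: "bool \<Rightarrow> ((nat \<Rightarrow> bool) \<Rightarrow> nat \<Rightarrow> nat) \<Rightarrow> bool" where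
  "computable_op orc F \<longleftrightarrow>
     (\<exists>p. (orc \<or> oracle_free p) \<and> (\<forall>x n. eval x p n = Some (F x n)))"

abbreviation pfst :: "nat \<Rightarrow> nat" where "pfst n \<equiv> fst (prod_decode n)"
abbreviation psnd :: "nat \<Rightarrow> nat" where "psnd n \<equiv> snd (prod_decode n)"

abbreviation Id_prog :: prog where "Id_prog \<equiv> Pair First Second"

primrec const_prog :: "nat \<Rightarrow> prog" where
  "const_prog 0 = Zero"
| "const_prog (Suc n) = Comp Succ (const_prog n)"

lemma eval_const_prog [simp]: "eval x (const_prog c) n = Some c"
  by (induction c) auto

lemma oracle_free_const_prog [simp]: "oracle_free (const_prog c)"
  by (induction c) auto

lemma computable_opI:
  "orc \<or> oracle_free p \<Longrightarrow> (\<And>x n. eval x p n = Some (F x n)) \<Longrightarrow> computable_op orc F"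
  unfolding computable_op_def by blast

lemma computable_op_id: "computable_op orc (\<lambda>x n. n)"
  by (rule computable_opI[of _ Id_prog]) auto

lemma computable_op_const: "computable_op orc (\<lambda>x n. c)"
  by (rule computable_opI[of _ "const_prog c"]) auto

lemma computable_op_comp:
  assumes "computable_op orc F" "computable_op orc G"
  shows "computable_op orc (\<lambda>x n. F x (G x n))"
proof -
  obtain p q where "orc \<or> oracle_free p" "\<And>x n. eval x p n = Some (F x n)"
    and "orc \<or> oracle_free q" "\<And>x n. eval x q n = Some (G x n)"
    using assms unfolding computable_op_def by blast
  then show ?thesis by (intro computable_opI[of _ "Comp p q"]) auto
qed

lemma computable_op_prod_encode:
  assumes "computable_op orc F" "computable_op orc G"
  shows "computable_op orc (\<lambda>x n. prod_encode (F x n, G x n))"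
proof -
  obtain p q where "orc \<or> oracle_free p" "\<And>x n. eval x p n = Some (F x n)"
    and "orc \<or> oracle_free q" "\<And>x n. eval x q n = Some (G x n)"
    using assms unfolding computable_op_def by blast
  then show ?thesis by (intro computable_opI[of _ "Pair p q"]) auto
qed

lemma computable_op_Suc:
  "computable_op orc F \<Longrightarrow> computable_op orc (\<lambda>x n. Suc (F x n))"
  by (rule computable_op_comp[of _ "\<lambda>x n. Suc n"]) (auto intro: computable_opI[of _ Succ])

lemma computable_op_pfst:
  "computable_op orc F \<Longrightarrow> computable_op orc (\<lambda>x n. pfst (F x n))"
  by (rule computable_op_comp[of _ "\<lambda>x n. pfst n"]) (auto intro: computable_opI[of _ First])

lemma computable_op_psnd:
  "computable_op orc F \<Longrightarrow> computable_op orc (\<lambda>x n. psnd (F x n))"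
  by (rule computable_op_comp[of _ "\<lambda>x n. psnd n"]) (auto intro: computable_opI[of _ Second])

lemma computable_op_oracle:
  "computable_op True F \<Longrightarrow> computable_op True (\<lambda>x n. of_bool (x (F x n)))"
  by (rule computable_op_comp[of _ "\<lambda>x n. of_bool (x n)"])
    (auto intro: computable_opI[of _ Oracle])

text \<open>
  Primitive recursion in the form in which it unifies with a goal: the step \<open>G\<close> may use the
  ambient input, the counter and the previous value, which are the components of the argument
  that \<^const>\<open>Prec\<close> passes to its second program.
\<close>

lemma computable_op_rec_nat:
  assumes "computable_op orc A" "computable_op orc N"
    and "computable_op orc (\<lambda>x s. G x (pfst s) (pfst (psnd s)) (psnd (psnd s)))"
  shows "computable_op orc (\<lambda>x n. rec_nat (A x n) (\<lambda>k v. G x n k v) (N x n))"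
proof -
  obtain p q where p: "orc \<or> oracle_free p" "\<And>x n. eval x p n = Some (A x n)"
    and q: "orc \<or> oracle_free q"
      "\<And>x s. eval x q s = Some (G x (pfst s) (pfst (psnd s)) (psnd (psnd s)))"
    using assms(1,3) unfolding computable_op_def by blast
  have "rec_nat (Some (A x a)) (\<lambda>k r. Option.bind r (\<lambda>v. Some (G x a k v))) m
      = Some (rec_nat (A x a) (\<lambda>k v. G x a k v) m)" for x a m
    by (induction m) auto
  then have "computable_op orc (\<lambda>x n. rec_nat (A x (pfst n)) (\<lambda>k v. G x (pfst n) k v) (psnd n))"
    using p q by (intro computable_opI[of _ "Prec p q"]) (auto split: prod.split)
  from computable_op_comp[OF this computable_op_prod_encode[OF computable_op_id assms(2)]]
  show ?thesis by simp
qed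

lemmas computable_op_basic =
  computable_op_id computable_op_const computable_op_prod_encode
  computable_op_pfst computable_op_psnd computable_op_Suc

lemma computable_op_add:
  assumes "computable_op orc F" "computable_op orc G"
  shows "computable_op orc (\<lambda>x n. F x n + G x n)"
proof -
  have add: "a + m = rec_nat a (\<lambda>k v. Suc v) m" for a m :: nat
    by (induction m) auto
  show ?thesis
    unfolding add by (intro computable_op_rec_nat computable_op_basic assms)
qed

text \<open>
  The factor is fixed, so a program may depend on it and recursion on it is iterated addition.
\<close>

lemma computable_op_const_mult:
  "computable_op orc F \<Longrightarrow> computable_op orc (\<lambda>x n. c * F x n)"
  by (induction c) (auto intro: computable_op_add computable_op_const)

lemma computable_op_pred:
  assumes "computable_op orc F"
  shows "computable_op orc (\<lambda>x n. F x n - 1)"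
proof -
  have pred: "m - 1 = rec_nat 0 (\<lambda>k v. k) m" for m :: nat
    by (cases m) auto
  show ?thesis
    unfolding pred by (intro computable_op_rec_nat computable_op_basic assms)
qed

lemma computable_op_diff_const:
  assumes "computable_op orc F"
  shows "computable_op orc (\<lambda>x n. F x n - c)"
proof (induction c)
  case 0
  then show ?case using assms by simp
next
  case (Suc c)
  from computable_op_pred[OF this] show ?case by simp
qed

definition decidable_op :: "bool \<Rightarrow> ((nat \<Rightarrow> bool) \<Rightarrow> nat \<Rightarrow> bool) \<Rightarrow> bool" where
  "decidable_op orc P \<longleftrightarrow> computable_op orc (\<lambda>x n. of_bool (P x n))"

lemma computable_op_if:
  assumes "decidable_op orc P" "computable_op orc F" "computable_op orc G"
  shows "computable_op orc (\<lambda>x n. if P x n then F x n else G x n)"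
proof -
  have if_rec: "(if c then a else b) = rec_nat b (\<lambda>k v. a) (of_bool c)" for a b :: nat and c
    by simp
  show ?thesis
    unfolding if_rec
    by (intro computable_op_rec_nat computable_op_comp[OF assms(2)] computable_op_basic
        assms(1)[unfolded decidable_op_def] assms(3))
qed

lemma decidable_op_not:
  assumes "decidable_op orc P"
  shows "decidable_op orc (\<lambda>x n. \<not> P x n)"
proof -
  have "of_bool (\<not> c) = (if c then 0 else 1 :: nat)" for c
    by simp
  then show ?thesis
    unfolding decidable_op_def
    by (simp only:) (intro computable_op_if computable_op_basic assms)
qed

lemma decidable_op_or:
  assumes "decidable_op orc P" "decidable_op orc Q"
  shows "decidable_op orc (\<lambda>x n. P x n \<or> Q x n)"
proof -
  have "of_bool (c \<or> d) = (if c then 1 else of_bool d :: nat)" for c d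
    by simp
  then show ?thesis
    unfolding decidable_op_def
    by (simp only:) (intro computable_op_if computable_op_basic assms(1)
        assms(2)[unfolded decidable_op_def])
qed

lemma decidable_op_eq_0:
  assumes "computable_op orc F"
  shows "decidable_op orc (\<lambda>x n. F x n = 0)"
proof -
  have eq_0: "of_bool (m = 0) = rec_nat 1 (\<lambda>k v. 0) m" for m :: nat
    by (cases m) auto
  show ?thesis
    unfolding decidable_op_def eq_0 by (intro computable_op_rec_nat computable_op_basic assms)
qed

lemma decidable_op_eq_const:
  assumes "computable_op orc F"
  shows "decidable_op orc (\<lambda>x n. F x n = c)"
proof (cases c)
  case 0
  then show ?thesis using decidable_op_eq_0[OF assms] by simp
next
  case (Suc d)
  \<comment> \<open>On the natural numbers this says \<open>c - 1 < m \<le> c\<close>, by truncated subtraction.\<close>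
  have eq: "m = c \<longleftrightarrow> \<not> (m - d = 0 \<or> \<not> m - c = 0)" for m
    using Suc by auto
  show ?thesis
    by (subst eq) (intro decidable_op_not decidable_op_or decidable_op_eq_0
        computable_op_diff_const assms)
qed

lemma computable_op_mod_4:
  assumes "computable_op orc F"
  shows "computable_op orc (\<lambda>x n. F x n mod 4)"
proof -
  have mod_4: "m mod 4 = rec_nat 0 (\<lambda>k v. if v = 3 then 0 else Suc v) m" for m :: nat
    by (induction m) (auto simp: mod_Suc)
  show ?thesis
    unfolding mod_4
    by (intro computable_op_rec_nat computable_op_if decidable_op_eq_const computable_op_basic
        assms)
qed

lemma computable_op_div_4:
  assumes "computable_op orc F"
  shows "computable_op orc (\<lambda>x n. F x n div 4)"
proof -
  have div_4: "m div 4 = rec_nat 0 (\<lambda>k v. if Suc k mod 4 = 0 then Suc v else v) m" for m :: nat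
    by (induction m) (auto simp: div_Suc)
  show ?thesis
    unfolding div_4
    by (intro computable_op_rec_nat computable_op_if decidable_op_eq_const computable_op_mod_4
        computable_op_basic assms)
qed

lemmas computable_op_intros =
  computable_op_basic computable_op_add computable_op_const_mult computable_op_diff_const
  computable_op_mod_4 computable_op_div_4 computable_op_if
  decidable_op_not decidable_op_or decidable_op_eq_const

lemma computable_iff: "computable f \<longleftrightarrow> computable_op False (\<lambda>x. f)"
  unfolding computable_def computable_op_def by simp

lemma computable_imp_computable_op: "computable f \<Longrightarrow> computable_op orc (\<lambda>x. f)"
  unfolding computable_def computable_op_def by blast

section \<open>A stack machine that runs programs\<close>

text \<open>
  Instructions act on a current value.  Besides running a program, they express what is left to
  do when a subprogram returns.  \<open>PairL a\<close> pairs the current value with a stored \<open>a\<close> on the left.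
  \<open>PairR q n\<close> still has to run \<open>q\<close> on \<open>n\<close> and put the current value to the left of its result.
  \<open>Search p n m\<close> expects the value of \<open>p\<close> at \<open>(n, m)\<close>, during a search for the least zero.  A
  configuration of the machine is a value with a stack of instructions, and the machine never
  recurses within a step, so that a step can be carried out on codes by a case distinction.
\<close>

datatype instr = Do prog | PairL nat | PairR prog nat | Search prog nat nat

fun step :: "(nat \<Rightarrow> bool) \<Rightarrow> nat \<times> instr list \<Rightarrow> nat \<times> instr list" where
  "step x (v, []) = (v, [])"
| "step x (v, Do Zero # L) = (0, L)"
| "step x (v, Do Succ # L) = (Suc v, L)"
| "step x (v, Do First # L) = (pfst v, L)"
| "step x (v, Do Second # L) = (psnd v, L)"
| "step x (v, Do Oracle # L) = (of_bool (x v), L)"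
| "step x (v, Do (Pair p q) # L) = (v, Do p # PairR q v # L)"
| "step x (v, Do (Comp p q) # L) = (v, Do q # Do p # L)"
| "step x (v, Do (Prec p q) # L) =
     (if psnd v = 0 then (pfst v, Do p # L)
      else (prod_encode (pfst v, psnd v - 1),
            Do (Prec p q) # PairL (psnd v - 1) # PairL (pfst v) # Do q # L))"
| "step x (v, Do (Mu p) # L) = (prod_encode (v, 0), Do p # Search p v 0 # L)"
| "step x (v, PairL a # L) = (prod_encode (a, v), L)"
| "step x (v, PairR q n # L) = (n, Do q # PairL v # L)"
| "step x (v, Search p n m # L) =
     (if v = 0 then (m, L)
      else (prod_encode (n, Suc m), Do p # Search p n (Suc m) # L))"

text \<open>
  The meaning of \<^const>\<open>Mu\<close> once the search has arrived at \<open>m\<close>, so that one step of the machine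
  is one unfolding.
\<close>

definition search :: "(nat \<Rightarrow> nat option) \<Rightarrow> nat \<Rightarrow> nat option" where
  "search f m =
     (let P = (\<lambda>j. m \<le> j \<and> f j = Some 0 \<and> (\<forall>k\<in>{m..<j}. f k \<noteq> None))
      in if \<exists>j. P j then Some (LEAST j. P j) else None)"

text \<open>
  A zero at \<open>m\<close> is the least one.  Otherwise the condition on the candidates from \<open>m\<close> on is the
  one from \<open>m + 1\<close> on together with convergence at \<open>m\<close>.
\<close>

lemma search_unfold:
  "search f m = Option.bind (f m) (\<lambda>v. if v = 0 then Some m else search f (Suc m))"
proof (cases "f m = Some 0")
  case True
  then have "(LEAST j. m \<le> j \<and> f j = Some 0 \<and> (\<forall>k\<in>{m..<j}. f k \<noteq> None)) = m"
    by (intro Least_equality) auto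
  moreover have "\<exists>j\<ge>m. f j = Some 0 \<and> (\<forall>k\<in>{m..<j}. f k \<noteq> None)"
    using True by (intro exI[of _ m]) auto
  ultimately show ?thesis using True by (simp add: search_def)
next
  case False
  have "(m \<le> j \<and> f j = Some 0 \<and> (\<forall>k\<in>{m..<j}. f k \<noteq> None)) \<longleftrightarrow>
        f m \<noteq> None \<and> Suc m \<le> j \<and> f j = Some 0 \<and> (\<forall>k\<in>{Suc m..<j}. f k \<noteq> None)" for j
  proof (cases "m < j")
    case True
    then have "{m..<j} = insert m {Suc m..<j}" by auto
    then show ?thesis using True by auto
  next
    case nless: False
    then show ?thesis using False by (auto simp: not_less)
  qed
  then show ?thesis using False by (cases "f m") (simp_all add: search_def Let_def)
qed

lemma eval_Mu_search: "eval x (Mu p) n = search (\<lambda>m. eval x p (prod_encode (n, m))) 0"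
  by (simp add: search_def Let_def Ball_def)

primrec meaning :: "(nat \<Rightarrow> bool) \<Rightarrow> instr \<Rightarrow> nat \<Rightarrow> nat option" where
  "meaning x (Do p) v = eval x p v"
| "meaning x (PairL a) v = Some (prod_encode (a, v))"
| "meaning x (PairR q n) v = map_option (\<lambda>b. prod_encode (v, b)) (eval x q n)"
| "meaning x (Search p n m) v =
     (if v = 0 then Some m else search (\<lambda>m. eval x p (prod_encode (n, m))) (Suc m))"

text \<open>
  The value that a configuration promises: all its instructions are carried out in sequence,
  with the semantics of programs in place of the machine.
\<close>

fun outcome :: "(nat \<Rightarrow> bool) \<Rightarrow> nat \<times> instr list \<Rightarrow> nat option" where
  "outcome x (v, []) = Some v"
| "outcome x (v, i # L) = Option.bind (meaning x i v) (\<lambda>w. outcome x (w, L))"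

lemma eval_Prec_Suc:
  "eval x (Prec p q) (prod_encode (a, Suc k)) =
     Option.bind (eval x (Prec p q) (prod_encode (a, k)))
       (\<lambda>v. eval x q (prod_encode (a, prod_encode (k, v))))"
  by simp

text \<open>
  This invariant makes the machine sound: if it stops with the empty stack and \<open>v\<close>, then \<open>v\<close> is
  what the initial configuration promised.
\<close>

lemma outcome_step: "outcome x (step x s) = outcome x s"
proof (induction x s rule: step.induct)
  \<comment> \<open>\<open>Pair\<close>: associativity of sequencing.\<close>
  case (7 x v p q L)
  then show ?case by (auto simp: Option.bind_assoc map_option_case split: option.splits bind_split)
next
  \<comment> \<open>\<open>Prec\<close>: the two left pairings rebuild the argument of the recursion step.\<close>
  case (9 x v p q L)
  obtain a m where v: "v = prod_encode (a, m)"
    by (metis prod_decode_inverse surj_pair)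
  show ?case
  proof (cases m)
    case 0
    then show ?thesis by (simp add: v)
  next
    case (Suc k)
    show ?thesis
      by (simp add: v Suc eval_Prec_Suc Option.bind_assoc del: eval.simps)
  qed
next
  \<comment> \<open>\<open>Mu\<close>: only the search on the right-hand side may be unfolded.\<close>
  case (10 x v p L)
  show ?case
    unfolding step.simps outcome.simps meaning.simps eval_Mu_search
    by (subst (2) search_unfold) (auto simp: Option.bind_assoc intro!: arg_cong2[where f=Option.bind])
next
  \<comment> \<open>\<open>Search\<close>: again the search from \<open>m + 1\<close> on is unfolded on one side only.\<close>
  case (13 x v p n m L)
  show ?case
    by (simp, subst (2) search_unfold) (auto simp: Option.bind_assoc  intro!: arg_cong2[where f=Option.bind])
qed (auto simp: Option.bind_assoc map_option_case split: option.splits bind_split)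

definition reaches ::
  "(nat \<Rightarrow> bool) \<Rightarrow> nat \<times> instr list \<Rightarrow> nat \<times> instr list \<Rightarrow> bool" where
  "reaches x s t \<longleftrightarrow> (\<exists>k. (step x ^^ k) s = t)"

lemma reaches_refl: "reaches x s s"
  unfolding reaches_def by (rule exI[of _ 0]) simp

lemma reaches_step: "reaches x (step x s) t \<Longrightarrow> reaches x s t"
  unfolding reaches_def by (metis funpow_simps_right(2) o_apply)

lemma reaches_trans: "reaches x s t \<Longrightarrow> reaches x t u \<Longrightarrow> reaches x s u"
  unfolding reaches_def by (metis funpow_add o_apply)

text \<open>
  Completeness of the machine.  The stack \<open>L\<close> below the program has to be arbitrary, since the
  subprograms run on top of the instructions that wait for their values.
\<close>

lemma eval_imp_reaches: "eval x p n = Some v \<Longrightarrow> reaches x (n, Do p # L) (v, L)"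
proof (induction p arbitrary: n v L)
  case (Pair p q)
  then obtain a b where ab: "eval x p n = Some a" "eval x q n = Some b" "v = prod_encode (a, b)"
    by (auto split: bind_splits)
  have "reaches x (n, Do p # PairR q n # L) (a, PairR q n # L)"
    using Pair.IH(1) ab by blast
  moreover have "reaches x (a, PairR q n # L) (b, PairL a # L)"
    by (rule reaches_step) (simp add: Pair.IH(2) ab)
  moreover have "reaches x (b, PairL a # L) (v, L)"
    by (rule reaches_step) (simp add: ab reaches_refl)
  ultimately have "reaches x (n, Do p # PairR q n # L) (v, L)"
    by (meson reaches_trans)
  then show ?case using reaches_step[of x "(n, Do (Pair p q) # L)"] by simp
next
  case (Comp p q)
  then obtain a where a: "eval x q n = Some a" "eval x p a = Some v"
    by (auto split: bind_splits)
  have "reaches x (n, Do q # Do p # L) (v, L)"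
    using Comp.IH(2)[OF a(1)] Comp.IH(1)[OF a(2)] by (rule reaches_trans)
  then show ?case using reaches_step[of x "(n, Do (Comp p q) # L)"] by simp
next
  case (Prec p q)
  obtain a m where n: "n = prod_encode (a, m)"
    by (metis prod_decode_inverse surj_pair)
  from Prec.prems show ?case
    unfolding n
  proof (induction m arbitrary: v L)
    case 0
    then have "eval x p a = Some v" by simp
    from Prec.IH(1)[OF this] show ?case
      using reaches_step[of x "(prod_encode (a, 0), Do (Prec p q) # L)"] by simp
  next
    case (Suc k)
    obtain w where w: "eval x (Prec p q) (prod_encode (a, k)) = Some w"
      "eval x q (prod_encode (a, prod_encode (k, w))) = Some v"
      using Suc.prems unfolding eval_Prec_Suc by (auto simp del: eval.simps split: bind_splits)
    have "reaches x (prod_encode (k, w), PairL a # Do q # L) (v, L)"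
      using Prec.IH(2)[OF w(2)]
        reaches_step[of x "(prod_encode (k, w), PairL a # Do q # L)"] by simp
    then have "reaches x (w, PairL k # PairL a # Do q # L) (v, L)"
      using reaches_step[of x "(w, PairL k # PairL a # Do q # L)"] by simp
    with Suc.IH[OF w(1)]
    have "reaches x (prod_encode (a, k), Do (Prec p q) # PairL k # PairL a # Do q # L) (v, L)"
      by (rule reaches_trans)
    then show ?case
      using reaches_step[of x "(prod_encode (a, Suc k), Do (Prec p q) # L)"] by simp
  qed
next
  case (Mu p)
  let ?f = "\<lambda>m. eval x p (prod_encode (n, m))"
  let ?P = "\<lambda>m. ?f m = Some 0 \<and> (\<forall>k<m. ?f k \<noteq> None)"
  have ex: "\<exists>m. ?P m" and v: "v = (LEAST m. ?P m)"
    using Mu.prems by (auto simp: Let_def split: if_splits)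
  have P: "?P v" unfolding v by (rule LeastI_ex[OF ex])
  have nz: "?f k \<noteq> Some 0" if "k < v" for k
    using that P not_less_Least[of k ?P] unfolding v by (meson less_trans)
  \<comment> \<open>Induction downwards from the least zero \<open>v\<close> to the start of the search.\<close>
  have "reaches x (prod_encode (n, m), Do p # Search p n m # L) (v, L)" if "m \<le> v" for m
    using that
  proof (induction rule: inc_induct)
    case base
    have "reaches x (0, Search p n v # L) (v, L)"
      by (rule reaches_step) (simp add: reaches_refl)
    with P show ?case using Mu.IH reaches_trans by blast
  next
    case (step m)
    obtain w where w: "?f m = Some w" "w \<noteq> 0"
      using P nz[of m] step.hyps by fastforce
    have "reaches x (w, Search p n m # L) (v, L)"
      using w step.IH reaches_step[of x "(w, Search p n m # L)"] by simp
    with w show ?case using Mu.IH reaches_trans by blast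
  qed
  from this[of 0] show ?case
    using reaches_step[of x "(n, Do (Mu p) # L)"] by simp
qed (rule reaches_step, force simp: reaches_refl)+

lemma outcome_funpow_step: "outcome x ((step x ^^ k) s) = outcome x s"
  by (induction k) (auto simp: outcome_step)

lemma eval_iff_machine:
  "eval x p n = Some v \<longleftrightarrow> (\<exists>k. (step x ^^ k) (n, [Do p]) = (v, []))"
proof
  assume "eval x p n = Some v"
  then show "\<exists>k. (step x ^^ k) (n, [Do p]) = (v, [])"
    using eval_imp_reaches unfolding reaches_def by blast
next
  assume "\<exists>k. (step x ^^ k) (n, [Do p]) = (v, [])"
  then obtain k where "(step x ^^ k) (n, [Do p]) = (v, [])" ..
  then have "outcome x (n, [Do p]) = Some v"
    using outcome_funpow_step[of x k "(n, [Do p])"] by simp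
  then show "eval x p n = Some v" by simp
qed

section \<open>The machine on codes\<close>

primrec instr_encode :: "instr \<Rightarrow> nat" where
  "instr_encode (Do p) = prod_encode (0, prog_encode p)"
| "instr_encode (PairL a) = prod_encode (1, a)"
| "instr_encode (PairR q n) = prod_encode (2, prod_encode (prog_encode q, n))"
| "instr_encode (Search p n m) = prod_encode (3, prod_encode (prog_encode p, prod_encode (n, m)))"

definition state_encode :: "nat \<times> instr list \<Rightarrow> nat" where
  "state_encode s = prod_encode (fst s, list_encode (map instr_encode (snd s)))"

text \<open>
  Codes of stacks are those of \<^const>\<open>list_encode\<close>: the empty stack is 0, and a nonempty one is
  the successor of a pair of an instruction and a stack.
\<close>

definition push :: "nat \<Rightarrow> nat \<Rightarrow> nat \<Rightarrow> nat" where
  "push tag d l = Suc (prod_encode (prod_encode (tag, d), l))"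

text \<open>
  The step for an instruction \<open>Do p\<close>, where \<open>e\<close> is the code of \<open>p\<close>, \<open>v\<close> the current value and \<open>l\<close> the
  code of the remaining stack.  The remainder of \<open>e - 5\<close> modulo 4 is the constructor of a compound
  program, and the quotient codes its components.  The values of \<open>push\<close> at its first argument are
  the tags in \<^const>\<open>instr_encode\<close>.
\<close>

definition do_code :: "(nat \<Rightarrow> bool) \<Rightarrow> nat \<Rightarrow> nat \<Rightarrow> nat \<Rightarrow> nat" where
  "do_code x e v l =
    (if e = 0 then prod_encode (0, l)
     else if e = 1 then prod_encode (Suc v, l)
     else if e = 2 then prod_encode (pfst v, l)
     else if e = 3 then prod_encode (psnd v, l)
     else if e = 4 then prod_encode (of_bool (x v), l)
     else if (e - 5) mod 4 = 0 then
       prod_encode (v, push 0 (pfst ((e - 5) div 4))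
         (push 2 (prod_encode (psnd ((e - 5) div 4), v)) l))
     else if (e - 5) mod 4 = 1 then
       prod_encode (v, push 0 (psnd ((e - 5) div 4)) (push 0 (pfst ((e - 5) div 4)) l))
     else if (e - 5) mod 4 = 2 then
       (if psnd v = 0 then prod_encode (pfst v, push 0 (pfst ((e - 5) div 4)) l)
        else prod_encode (prod_encode (pfst v, psnd v - 1),
          push 0 e (push 1 (psnd v - 1) (push 1 (pfst v) (push 0 (psnd ((e - 5) div 4)) l)))))
     else prod_encode (prod_encode (v, 0), push 0 ((e - 5) div 4)
       (push 3 (prod_encode ((e - 5) div 4, prod_encode (v, 0))) l)))"

definition step_code :: "(nat \<Rightarrow> bool) \<Rightarrow> nat \<Rightarrow> nat \<Rightarrow> nat \<Rightarrow> nat \<Rightarrow> nat" where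
  "step_code x tag d v l =
    (if tag = 0 then do_code x d v l
     else if tag = 1 then prod_encode (prod_encode (d, v), l)
     else if tag = 2 then prod_encode (psnd d, push 0 (pfst d) (push 1 v l))
     else if v = 0 then prod_encode (psnd (psnd d), l)
     else prod_encode (prod_encode (pfst (psnd d), Suc (psnd (psnd d))),
       push 0 (pfst d) (push 3 (prod_encode (pfst d,
         prod_encode (pfst (psnd d), Suc (psnd (psnd d))))) l)))"

definition state_step :: "(nat \<Rightarrow> bool) \<Rightarrow> nat \<Rightarrow> nat" where
  "state_step x s =
    (if psnd s = 0 then s
     else step_code x (pfst (pfst (psnd s - 1))) (psnd (pfst (psnd s - 1)))
       (pfst s) (psnd (psnd s - 1)))"

lemma do_code_correct:
  "do_code x (prog_encode p) v (list_encode (map instr_encode L)) =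
     state_encode (step x (v, Do p # L))"
proof -
  have "Suc (4 * k) mod 4 = 1" "Suc (Suc (4 * k)) mod 4 = 2" "Suc (Suc (Suc (4 * k))) mod 4 = 3"
    "Suc (4 * k) div 4 = k" "Suc (Suc (4 * k)) div 4 = k" "Suc (Suc (Suc (4 * k))) div 4 = k"
    for k :: nat by presburger+
  then show ?thesis
    by (cases p) (simp_all add: do_code_def state_encode_def push_def)
qed

lemma state_step_correct: "state_step x (state_encode s) = state_encode (step x s)"
proof -
  obtain v L where s: "s = (v, L)" by force
  show ?thesis
  proof (cases L)
    case Nil
    then show ?thesis by (simp add: s state_step_def state_encode_def)
  next
    case (Cons i M)
    show ?thesis
      using do_code_correct[of x _ v M]
      by (cases i) (auto simp: s Cons state_step_def step_code_def state_encode_def push_def)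
  qed
qed

lemma computable_op_push:
  "computable_op orc T \<Longrightarrow> computable_op orc D \<Longrightarrow> computable_op orc L \<Longrightarrow>
   computable_op orc (\<lambda>x n. push (T x n) (D x n) (L x n))"
  unfolding push_def by (intro computable_op_intros)

lemma computable_op_do_code:
  assumes "computable_op True E" "computable_op True V" "computable_op True L"
  shows "computable_op True (\<lambda>x n. do_code x (E x n) (V x n) (L x n))"
  unfolding do_code_def
  by (intro computable_op_intros computable_op_push computable_op_oracle assms)

lemma computable_op_state_step:
  assumes "computable_op True S"
  shows "computable_op True (\<lambda>x n. state_step x (S x n))"
  unfolding state_step_def step_code_def
  by (intro computable_op_intros computable_op_push computable_op_do_code assms)

definition run_code :: "(nat \<Rightarrow> bool) \<Rightarrow> nat \<Rightarrow> nat \<Rightarrow> nat \<Rightarrow> nat" where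
  "run_code x e n k =
     rec_nat (prod_encode (n, push 0 e 0)) (\<lambda>_. state_step x) k"

text \<open>
  Zero means that the machine has not halted after \<open>k\<close> steps; otherwise it is the successor of
  the result.  A halted configuration is a fixed point of the step, so a result persists.
\<close>

definition result_at :: "(nat \<Rightarrow> bool) \<Rightarrow> nat \<Rightarrow> nat \<Rightarrow> nat \<Rightarrow> nat" where
  "result_at x e n k =
     (if psnd (run_code x e n k) = 0 then Suc (pfst (run_code x e n k)) else 0)"

lemma run_code_eq:
  "run_code x (prog_encode p) n k = state_encode ((step x ^^ k) (n, [Do p]))"
proof (induction k)
  case 0
  then show ?case by (simp add: run_code_def state_encode_def push_def)
next
  case (Suc k)
  have "run_code x (prog_encode p) n (Suc k) = state_step x (run_code x (prog_encode p) n k)"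
    by (simp add: run_code_def)
  then show ?case by (simp add: Suc.IH state_step_correct)
qed

lemma phi_iff_result_at: "phi x e n = Some v \<longleftrightarrow> (\<exists>k. result_at x e n k = Suc v)"
proof -
  obtain p where e: "e = prog_encode p" using surj_prog_encode by blast
  have "result_at x e n k = Suc v \<longleftrightarrow> (step x ^^ k) (n, [Do p]) = (v, [])" for k
    by (cases "(step x ^^ k) (n, [Do p])"; cases "snd ((step x ^^ k) (n, [Do p]))")
      (auto simp: result_at_def e run_code_eq state_encode_def)
  then show ?thesis by (simp add: e phi_prog_encode eval_iff_machine)
qed

lemma computable_op_result_at:
  assumes "computable_op True E" "computable_op True N" "computable_op True K"
  shows "computable_op True (\<lambda>x n. result_at x (E x n) (N x n) (K x n))"
proof -
  have "computable_op True (\<lambda>x n. run_code x (E x n) (N x n) (K x n))"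
    unfolding run_code_def
    by (intro computable_op_rec_nat computable_op_state_step computable_op_push
        computable_op_basic assms)
  then show ?thesis
    unfolding result_at_def by (intro computable_op_intros)
qed

lemma eval_Mu_total:
  assumes "\<And>m. eval x p (prod_encode (n, m)) = Some (f m)"
  shows "eval x (Mu p) n = (if \<exists>m. f m = 0 then Some (LEAST m. f m = 0) else None)"
  using assms by (simp add: Let_def)

text \<open>
  Search for the number of steps after which the machine halts, then read off the result.  It is
  the same program for all oracles, so its oracle calls can later be replaced by a program.
\<close>

lemma universal_program: "\<exists>u. \<forall>x e n. eval x u (prod_encode (e, n)) = phi x e n"
proof -
  have "computable_op True (\<lambda>x s. of_bool (result_at x (pfst (pfst s)) (psnd (pfst s)) (psnd s) = 0))"
    unfolding decidable_op_def[symmetric]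
    by (intro computable_op_intros computable_op_result_at)
  then obtain p where p: "\<And>x s. eval x p s =
      Some (of_bool (result_at x (pfst (pfst s)) (psnd (pfst s)) (psnd s) = 0))"
    unfolding computable_op_def by blast
  have "computable_op True (\<lambda>x s. result_at x (pfst (pfst s)) (psnd (pfst s)) (psnd s) - 1)"
    by (intro computable_op_intros computable_op_result_at)
  then obtain q where q: "\<And>x s. eval x q s =
      Some (result_at x (pfst (pfst s)) (psnd (pfst s)) (psnd s) - 1)"
    unfolding computable_op_def by blast
  have "eval x (Comp q (Pair Id_prog (Mu p))) (prod_encode (e, n)) = phi x e n" for x e n
  proof (cases "\<exists>k. result_at x e n k \<noteq> 0")
    case True
    let ?k = "LEAST k. result_at x e n k \<noteq> 0"
    from True have "result_at x e n ?k \<noteq> 0" by (rule LeastI_ex)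
    then have "result_at x e n ?k = Suc (result_at x e n ?k - 1)" by simp
    then have "phi x e n = Some (result_at x e n ?k - 1)"
      unfolding phi_iff_result_at by blast
    with True show ?thesis
      by (simp add: eval_Mu_total[of x p "prod_encode (e, n)"
            "\<lambda>k. of_bool (result_at x e n k = 0)"] p q del: eval.simps(9))
  next
    case False
    then have "phi x e n = None"
      by (metis not_Some_eq phi_iff_result_at nat.distinct(1))
    with False show ?thesis
      by (simp add: eval_Mu_total[of x p "prod_encode (e, n)"
            "\<lambda>k. of_bool (result_at x e n k = 0)"] p q del: eval.simps(9))
  qed
  then show ?thesis by blast
qed

section \<open>Borel measurability\<close>

lemma measurable_option_bind:
  fixes g :: "nat \<Rightarrow> 'a \<Rightarrow> nat option"
  assumes "f \<in> M \<rightarrow>\<^sub>M count_space UNIV" "\<And>a. g a \<in> M \<rightarrow>\<^sub>M count_space UNIV"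
  shows "(\<lambda>x. Option.bind (f x) (\<lambda>a. g a x)) \<in> M \<rightarrow>\<^sub>M count_space UNIV"
proof -
  have "(\<lambda>x. Option.bind r (\<lambda>a. g a x)) \<in> M \<rightarrow>\<^sub>M count_space UNIV" for r
    using assms(2) by (cases r) auto
  then show ?thesis
    by (rule measurable_compose_countable'[where I = UNIV, OF _ assms(1)]) auto
qed

text \<open>
  Partial values form a countable discrete space, so measurability survives sequencing, even
  though a program is then evaluated at an input that itself depends on \<open>x\<close>.
\<close>

lemma measurable_eval:
  "(\<lambda>x. eval x p n) \<in> borel \<rightarrow>\<^sub>M count_space (UNIV :: nat option set)"
proof (induction p arbitrary: n)
  case Oracle
  have "(\<lambda>x :: nat \<Rightarrow> bool. x n) \<in> borel \<rightarrow>\<^sub>M borel"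
    by (intro borel_measurable_continuous_onI continuous_on_product_coordinates)
  \<comment> \<open>The type of truth values is countable, so all its subsets are Borel.\<close>
  then have [measurable]: "(\<lambda>x :: nat \<Rightarrow> bool. x n) \<in> borel \<rightarrow>\<^sub>M count_space UNIV"
    using measurable_cong_sets[OF refl sets_borel_eq_count_space] by blast
  show ?case by simp
next
  case (Pair p q)
  then show ?case by (auto intro!: measurable_option_bind)
next
  case (Comp p q)
  then show ?case by (auto intro!: measurable_option_bind)
next
  case (Prec p q)
  obtain a m where n: "n = prod_encode (a, m)"
    by (metis prod_decode_inverse surj_pair)
  show ?case
    unfolding n
  proof (induction m)
    case 0
    then show ?case using Prec.IH by simp
  next
    case (Suc m)
    then show ?case
      unfolding eval_Prec_Suc using Prec.IH by (intro measurable_option_bind)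
  qed
next
  case (Mu p)
  note [measurable] = Mu
  show ?case unfolding eval.simps Let_def by measurable
qed auto

lemma borel_measurable_phi_eq: "phi_eq \<in> borel \<rightarrow>\<^sub>M borel"
proof (rule measurable_coordinatewise_then_product)
  fix ij :: "nat \<times> nat"
  obtain i j where ij: "ij = (i, j)" by force
  note [measurable] = measurable_eval
  have "(\<lambda>x. \<forall>n. phi x i n = phi x j n) \<in> borel \<rightarrow>\<^sub>M count_space UNIV"
    unfolding phi_def by measurable
  then have "(\<lambda>x. phi_eq x ij) \<in> borel \<rightarrow>\<^sub>M count_space UNIV"
    by (simp add: ij phi_eq_def fun_eq_iff)
  then show "(\<lambda>x. phi_eq x ij) \<in> borel \<rightarrow>\<^sub>M borel"
    using measurable_cong_sets[OF refl sets_borel_eq_count_space] by blast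
qed

section \<open>Turing reductions and reductions of program equivalence\<close>

lemma turing_le_iff_prog: "x \<le>\<^sub>T y \<longleftrightarrow> (\<exists>p. \<forall>n. eval y p n = Some (of_bool (x n)))"
  unfolding turing_le_def phi_def by (metis bij_prog_encode bij_inv_eq_iff)

definition const_code :: "nat \<Rightarrow> nat" where
  "const_code c = prog_encode (const_prog c)"

lemma computable_op_const_code:
  assumes "computable_op orc F"
  shows "computable_op orc (\<lambda>x n. const_code (F x n))"
proof -
  have const_code_rec: "const_code c = rec_nat 0 (\<lambda>k v. 6 + 4 * prod_encode (1, v)) c" for c
    by (induction c) (auto simp: const_code_def)
  show ?thesis
    unfolding const_code_rec by (intro computable_op_rec_nat computable_op_intros assms)
qed

primrec subst_oracle :: "prog \<Rightarrow> prog \<Rightarrow> prog" where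
  "subst_oracle p Zero = Zero"
| "subst_oracle p Succ = Succ"
| "subst_oracle p First = First"
| "subst_oracle p Second = Second"
| "subst_oracle p Oracle = p"
| "subst_oracle p (Pair q r) = Pair (subst_oracle p q) (subst_oracle p r)"
| "subst_oracle p (Comp q r) = Comp (subst_oracle p q) (subst_oracle p r)"
| "subst_oracle p (Prec q r) = Prec (subst_oracle p q) (subst_oracle p r)"
| "subst_oracle p (Mu q) = Mu (subst_oracle p q)"

lemma eval_subst_oracle:
  assumes "\<And>n. eval y p n = Some (of_bool (x n))"
  shows "eval y (subst_oracle p q) = eval x q"
proof -
  have "eval y p = (\<lambda>n. Some (of_bool (x n)))"
    by (simp add: assms fun_eq_iff)
  then show ?thesis by (induction q) simp_all
qed

text \<open>
  The reduction hardwires its argument as the first input of the universal program, after the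
  oracle calls of that program have been replaced once and for all.  Only the constant depends
  on the argument, so the reduction needs no recursion through the structure of programs.
\<close>

lemma turing_le_imp_comp_le:
  assumes "x \<le>\<^sub>T y"
  shows "phi_eq x \<le>\<^sub>c phi_eq y"
proof -
  obtain p where p: "\<And>n. eval y p n = Some (of_bool (x n))"
    using assms unfolding turing_le_iff_prog by blast
  obtain u where u: "\<And>x e n. eval x u (prod_encode (e, n)) = phi x e n"
    using universal_program by blast
  define w where "w = subst_oracle p u"
  define f where "f i = prog_encode (Comp w (Pair (const_prog i) Id_prog))" for i
  have "phi y (f i) = phi x i" for i
    unfolding f_def phi_prog_encode
    by (simp add: fun_eq_iff w_def eval_subst_oracle[OF p] u)
  then have "reduction_on UNIV (curry (phi_eq x)) UNIV (curry (phi_eq y)) f"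
    by (simp add: reduction_on_def phi_eq_def)
  moreover have "computable f"
    unfolding computable_iff f_def prog_encode.simps(6,7) const_code_def[symmetric]
    by (intro computable_op_intros computable_op_const_code)
  ultimately show ?thesis unfolding comp_le_def by blast
qed

text \<open>
  For each \<open>n\<close> exactly one of the two computations returns \<open>v\<close>, so a search for a number of steps
  after which one of them has done so terminates, and \<open>x n\<close> says which one it was.
\<close>

lemma turing_leI_semidecidable:
  assumes "computable h" "computable h'"
    and "\<And>n. x n \<longleftrightarrow> phi y (h n) m = Some v"
    and "\<And>n. \<not> x n \<longleftrightarrow> phi y (h' n) m = Some v"
  shows "x \<le>\<^sub>T y"
proof -
  note h = assms(1,2)[THEN computable_imp_computable_op, THEN computable_op_comp]
  let ?r = "\<lambda>x n k. result_at x (h n) m k" and ?r' = "\<lambda>x n k. result_at x (h' n) m k"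
  let ?found = "\<lambda>x n k. ?r x n k = Suc v \<or> ?r' x n k = Suc v"
  have "computable_op True (\<lambda>x s. of_bool (\<not> ?found x (pfst s) (psnd s)))"
    unfolding decidable_op_def[symmetric]
    by (intro computable_op_intros computable_op_result_at h)
  then obtain p where p: "\<And>x s. eval x p s = Some (of_bool (\<not> ?found x (pfst s) (psnd s)))"
    unfolding computable_op_def by blast
  have "computable_op True (\<lambda>x s. of_bool (?r x (pfst s) (psnd s) = Suc v))"
    unfolding decidable_op_def[symmetric]
    by (intro computable_op_intros computable_op_result_at h)
  then obtain q where q: "\<And>x s. eval x q s = Some (of_bool (?r x (pfst s) (psnd s) = Suc v))"
    unfolding computable_op_def by blast
  have "eval y (Comp q (Pair Id_prog (Mu p))) n = Some (of_bool (x n))" for n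
  proof -
    let ?k = "LEAST k. ?found y n k"
    have ex: "\<exists>k. ?found y n k"
      using assms(3,4)[of n] unfolding phi_iff_result_at by blast
    then have "?found y n ?k" by (rule LeastI_ex)
    then have "?r y n ?k = Suc v \<longleftrightarrow> x n"
      using assms(3,4)[of n] unfolding phi_iff_result_at by blast
    moreover have "eval y (Mu p) n = Some ?k"
      using ex by (simp add: eval_Mu_total[of y p n "\<lambda>k. of_bool (\<not> ?found y n k)"] p
          del: eval.simps(9))
    ultimately show ?thesis by (simp add: q del: eval.simps(9))
  qed
  then show ?thesis unfolding turing_le_iff_prog by blast
qed

text \<open>
  Two inequivalent programs need not be separated by an input at which both halt, so a single
  test would only show that \<open>x\<close> or its complement is semidecidable with oracle \<open>y\<close>.  Since the
  roles of the two constants can be exchanged before \<open>f\<close> is applied, one separating input gives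
  both.
\<close>

lemma comp_le_imp_turing_le:
  assumes "phi_eq x \<le>\<^sub>c phi_eq y"
  shows "x \<le>\<^sub>T y"
proof -
  obtain f where f: "computable f"
    and red: "\<And>i j. phi x i = phi x j \<longleftrightarrow> phi y (f i) = phi y (f j)"
    using assms unfolding comp_le_def reduction_on_def phi_eq_def by auto
  have const: "phi x (const_code c) = (\<lambda>_. Some c)" for c
    by (simp add: const_code_def phi_prog_encode fun_eq_iff)
  have "phi y (f (const_code 0)) \<noteq> phi y (f (const_code 1))"
    unfolding red[symmetric] const by (simp add: fun_eq_iff)
  then obtain m where "phi y (f (const_code 0)) m \<noteq> phi y (f (const_code 1)) m"
    by (auto simp: fun_eq_iff)
  \<comment> \<open>At least one of the two images halts at \<open>m\<close>; \<open>a\<close> is the constant for which it does.\<close>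
  then obtain a b v where ab: "phi y (f (const_code a)) m = Some v"
    "phi y (f (const_code b)) m \<noteq> Some v"
    by (metis not_Some_eq)
  \<comment> \<open>The program \<open>r\<close> composed with the constant \<open>n\<close> ignores its input and queries \<open>x\<close> at \<open>n\<close>.\<close>
  have select: "\<exists>h. computable h \<and>
      (\<forall>n. phi y (h n) = phi y (f (const_code (if x n then c else d))))" for c d
  proof -
    have "decidable_op True (\<lambda>x n. x n)"
      unfolding decidable_op_def by (intro computable_op_oracle computable_op_id)
    then have "computable_op True (\<lambda>x n. if x n then c else d)"
      by (intro computable_op_if computable_op_const)
    then obtain r where r: "\<And>x n. eval x r n = Some (if x n then c else d)"
      unfolding computable_op_def by blast
    define e where "e n = prog_encode (Comp r (const_prog n))" for n
    have "phi x (e n) = phi x (const_code (if x n then c else d))" for n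
      unfolding const by (simp add: e_def phi_prog_encode fun_eq_iff r del: prog_encode.simps)
    then have "phi y (f (e n)) = phi y (f (const_code (if x n then c else d)))" for n
      by (simp add: red)
    moreover have "computable (\<lambda>n. f (e n))"
      unfolding computable_iff e_def prog_encode.simps(7) const_code_def[symmetric]
      by (intro computable_op_comp[OF computable_imp_computable_op[OF f]]
          computable_op_intros computable_op_const_code)
    ultimately show ?thesis by blast
  qed
  obtain h h' where "computable h"
    "\<And>n. phi y (h n) = phi y (f (const_code (if x n then a else b)))"
    and "computable h'"
    "\<And>n. phi y (h' n) = phi y (f (const_code (if x n then b else a)))"
    using select[of a b] select[of b a] by blast
  then show ?thesis
    using ab by (intro turing_leI_semidecidable[of h h' x y m v]) auto
qed

theorem theorem4p5:
  shows "borel_reduction_on UNIV (\<le>\<^sub>T) ER (\<le>\<^sub>c) phi_eq \<and>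
         borel_reduction_on UNIV (\<equiv>\<^sub>T) ER (\<sim>\<^sub>c) phi_eq"
proof -
  have "x \<le>\<^sub>T y \<longleftrightarrow> phi_eq x \<le>\<^sub>c phi_eq y" for x y
    using turing_le_imp_comp_le comp_le_imp_turing_le by blast
  moreover have "phi_eq \<in> restrict_space borel UNIV \<rightarrow>\<^sub>M restrict_space borel ER"
    using borel_measurable_phi_eq phi_eq_in_ER
    by (intro measurable_restrict_space1 measurable_restrict_space2) auto
  ultimately show ?thesis
    by (simp add: borel_reduction_on_def reduction_on_def turing_equiv_def comp_equiv_def
        phi_eq_in_ER)
qed

end
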